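(* Let $X$ be an extremally disconnected compact Hausdorff space, $Z$ be an extremally connected space, $(cX,c)$ be an arbitrary C-semiregular extension of $X$ and $f:X\to Z$ be a continuous map such that, for every $x\in X$, $f(x)$ is a u-point of $Z$. Then there exists a continuous map $f':cX\to Z$ such that $f=f'\circ c$. In particular, for every open map $f:X\to Z$ there exists a continuous map $f':cX\to Z$ such that $f=f'\circ c$.
   Context: Open maps are assumed continuous. A space is extremally disconnected if the closure of every open set is open. For a space $T$, $RC(T)$ is the Boolean algebra of regular closed subsets ($F=\mathrm{cl}(\mathrm{int}F)$) with $a+b=a\cup b$, $a^*=\mathrm{cl}(T\setminus a)$, $a\cdot b=\mathrm{cl}(\mathrm{int}(a\cap b))$, $0=\emptyset$, $1=T$. For $t\in T$, $\sigma_t=\{F\in RC(T)\mid t\in F\}$; $T$ is semiregular if $RC(T)$ is a closed base for $T$. A grill of a Boolean algebra $B$ is a non-empty $\Gamma\subseteq B$ such that $0\notin\Gamma$; $a\in\Gamma$, $a\le b$ imply $b\in\Gamma$; and $a+b\in\Gamma$ implies $a\in\Gamma$ or $b\in\Gamma$. A semiregular $T_0$-space $T$ is extremally connected if for every grill $\Gamma$ of $RC(T)$ there is $t\in T$ with $\Gamma=\sigma_t$. A semiregular $T_0$-space $T$ is C-semiregular if for every grill $\Gamma$ of $RC(T)$ such that $F\cap G\neq\emptyset$ for all $F,G\in\Gamma$ there is $t\in T$ with $\Gamma=\sigma_t$. A point $t$ of $T$ is a u-point if for all open $U,V\subseteq T$, $t\in\mathrm{cl}(U)\cap\mathrm{cl}(V)$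 implies $t\in\mathrm{cl}(U\cap V)$. A C-semiregular extension of $X$ is a pair $(cX,c)$ where $cX$ is a C-semiregular space and $c:X\to cX$ is a dense embedding. *)

theory Defs
  imports "HOL-Analysis.Analysis"
begin

definition extremally_disconnected_space :: "'a topology \<Rightarrow> bool" where
  "extremally_disconnected_space T \<longleftrightarrow> (\<forall>U. openin T U \<longrightarrow> openin T (T closure_of U))"

text \<open>The regular closed sets. As a Boolean algebra they have zero \<open>{}\<close>, join \<open>(\<union>)\<close>, and hence
  the order \<open>a + b = b\<close>, that is, inclusion; grills involve no other part of the structure.\<close>

definition RC :: "'a topology \<Rightarrow> 'a set set" where
  "RC T = {F. F \<subseteq> topspace T \<and> F = T closure_of (T interior_of F)}"

text \<open>Grills of a Boolean algebra with carrier \<open>B\<close>, zero \<open>z\<close> and join \<open>j\<close>;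
  \<open>j a b = b\<close> expresses \<open>a \<le> b\<close>.\<close>

definition grill :: "'b set \<Rightarrow> 'b \<Rightarrow> ('b \<Rightarrow> 'b \<Rightarrow> 'b) \<Rightarrow> 'b set \<Rightarrow> bool" where
  "grill B z j \<Gamma> \<longleftrightarrow>
     \<Gamma> \<noteq> {} \<and> \<Gamma> \<subseteq> B \<and> z \<notin> \<Gamma> \<and>
     (\<forall>a\<in>\<Gamma>. \<forall>b\<in>B. j a b = b \<longrightarrow> b \<in> \<Gamma>) \<and>
     (\<forall>a\<in>B. \<forall>b\<in>B. j a b \<in> \<Gamma> \<longrightarrow> a \<in> \<Gamma> \<or> b \<in> \<Gamma>)"

abbreviation RC_grill :: "'a topology \<Rightarrow> 'a set set \<Rightarrow> bool" where
  "RC_grill T \<equiv> grill (RC T) {} (\<union>)"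

definition point_grill :: "'a topology \<Rightarrow> 'a \<Rightarrow> 'a set set" where
  "point_grill T t = {F \<in> RC T. t \<in> F}"

text \<open>The intersection with \<open>topspace T\<close> makes the empty intersection equal to the whole space.\<close>

definition closed_base :: "'a topology \<Rightarrow> 'a set set \<Rightarrow> bool" where
  "closed_base T \<B> \<longleftrightarrow>
     (\<forall>F\<in>\<B>. closedin T F) \<and>
     (\<forall>C. closedin T C \<longrightarrow> (\<exists>\<U>\<subseteq>\<B>. C = topspace T \<inter> \<Inter>\<U>))"

definition semiregular_space :: "'a topology \<Rightarrow> bool" where
  "semiregular_space T \<longleftrightarrow> closed_base T (RC T)"

definition extremally_connected_space :: "'a topology \<Rightarrow> bool" where
  "extremally_connected_space T \<longleftrightarrow>
     semiregular_space T \<and> t0_space T \<and>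
     (\<forall>\<Gamma>. RC_grill T \<Gamma> \<longrightarrow> (\<exists>t\<in>topspace T. \<Gamma> = point_grill T t))"

definition C_semiregular_space :: "'a topology \<Rightarrow> bool" where
  "C_semiregular_space T \<longleftrightarrow>
     semiregular_space T \<and> t0_space T \<and>
     (\<forall>\<Gamma>. RC_grill T \<Gamma> \<and> (\<forall>F\<in>\<Gamma>. \<forall>G\<in>\<Gamma>. F \<inter> G \<noteq> {}) \<longrightarrow>
        (\<exists>t\<in>topspace T. \<Gamma> = point_grill T t))"

definition u_point :: "'a topology \<Rightarrow> 'a \<Rightarrow> bool" where
  "u_point T t \<longleftrightarrow>
     t \<in> topspace T \<and>
     (\<forall>U V. openin T U \<and> openin T V \<and> t \<in> T closure_of U \<inter> T closure_of V \<longrightarrow>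
        t \<in> T closure_of (U \<inter> V))"

definition C_semiregular_extension :: "'a topology \<Rightarrow> 'c topology \<Rightarrow> ('a \<Rightarrow> 'c) \<Rightarrow> bool" where
  "C_semiregular_extension X cX c \<longleftrightarrow>
     C_semiregular_space cX \<and>
     embedding_map X cX c \<and> cX closure_of (c ` topspace X) = topspace cX"

end

(* A point y of the extension cX is sent to the point of Z whose grill consists of the regular
   closed F with y in the closure of c(f^-1(F)). This is a grill because preimages and closures
   commute with finite unions, so extremal connectedness of Z supplies the point. The preimage of F
   under the resulting map is the closure of c(f^-1(F)), which gives continuity; and that closure
   meets c(X) exactly in c(f^-1(F)), so on c(X) the map agrees with f by the T0 axiom. *)
theory Submission
  imports Defs
begin

text \<open>By T0 some closed set contains exactly one of two distinct points. It is an intersection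
  of basic closed sets, so one of these already separates the points.\<close>

lemma closed_base_separates:
  assumes "closed_base T \<B>" "t0_space T" "x \<in> topspace T" "y \<in> topspace T"
    and "\<And>F. F \<in> \<B> \<Longrightarrow> x \<in> F \<longleftrightarrow> y \<in> F"
  shows "x = y"
proof (rule ccontr)
  assume "x \<noteq> y"
  then obtain C where C: "closedin T C" "x \<in> C \<longleftrightarrow> y \<notin> C"
    using assms(2-4) unfolding t0_space by metis
  then obtain \<U> where "\<U> \<subseteq> \<B>" "C = topspace T \<inter> \<Inter>\<U>"
    using assms(1) unfolding closed_base_def by metis
  then show False using C(2) assms(3-5) by blast
qed

lemma continuous_map_closed_base:
  assumes "closed_base Z \<B>" and fim: "f \<in> topspace Y \<rightarrow> topspace Z"
    and cl: "\<And>F. F \<in> \<B> \<Longrightarrow> closedin Y {y \<in> topspace Y. f y \<in> F}"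
  shows "continuous_map Y Z f"
  unfolding continuous_map_closedin
proof (intro conjI allI impI)
  show "f \<in> topspace Y \<rightarrow> topspace Z"
    by (rule fim)
next
  fix C assume "closedin Z C"
  then obtain \<U> where \<U>: "\<U> \<subseteq> \<B>" "C = topspace Z \<inter> \<Inter>\<U>"
    using assms(1) unfolding closed_base_def by metis
  \<comment> \<open>Preimages commute with intersections. Inserting \<open>topspace Y\<close> covers
    the case of empty \<open>\<U>\<close> and makes the family non-empty, as
    \<open>closedin_Inter\<close> demands.\<close>
  then have "{y \<in> topspace Y. f y \<in> C} =
      \<Inter>(insert (topspace Y) ((\<lambda>F. {y \<in> topspace Y. f y \<in> F}) ` \<U>))"
    using fim by auto
  also have "closedin Y \<dots>"
    using \<U>(1) cl by (intro closedin_Inter) auto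
  finally show "closedin Y {y \<in> topspace Y. f y \<in> C}" .
qed

text \<open>An embedding is closed onto its image, so \<open>c\<close>
  A\<open>is the trace on that image of a closed set\<close>D\<open>of\<close>Y\<open>. The closure of\<close>c
  \<open>A\<close> stays inside \<open>D\<close> and so gains no new point of the image; injectivity
  then brings the claim back to \<open>X\<close>.\<close>

lemma embedding_map_in_closure_of_image_iff:
  assumes c: "embedding_map X Y c" and A: "closedin X A" and x: "x \<in> topspace X"
  shows "c x \<in> Y closure_of (c ` A) \<longleftrightarrow> x \<in> A"
proof
  have hom: "homeomorphic_map X (subtopology Y (c ` topspace X)) c"
    using c by (simp add: embedding_map_def)
  then have inj: "inj_on c (topspace X)"
    by (rule homeomorphic_imp_injective_map)
  from hom have "closedin (subtopology Y (c ` topspace X)) (c ` A)"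
    using A homeomorphic_imp_closed_map unfolding closed_map_def by blast
  then obtain D where D: "closedin Y D" "c ` A = D \<inter> c ` topspace X"
    unfolding closedin_subtopology by blast
  assume "c x \<in> Y closure_of (c ` A)"
  then have "c x \<in> D"
    using D closure_of_minimal[of "c ` A" D Y] by blast
  then have "c x \<in> c ` A" using D(2) x by blast
  then show "x \<in> A"
    using inj closedin_subset[OF A] x by (meson inj_on_image_mem_iff)
next
  have "c ` topspace X \<subseteq> topspace Y"
    using c embedding_map_in_subtopology[of X Y "topspace Y" c] by simp
  moreover assume "x \<in> A"
  ultimately show "c x \<in> Y closure_of (c ` A)"
    using closure_of_subset[of "c ` A" Y] closedin_subset[OF A] by blast
qed

lemma topspace_in_RC: "topspace T \<in> RC T"
  by (simp add: RC_def)

lemma RC_grill_preimage_closures: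
  assumes f: "f \<in> topspace X \<rightarrow> topspace Z"
    and dense: "Y closure_of (c ` topspace X) = topspace Y" and y: "y \<in> topspace Y"
  shows "RC_grill Z {F \<in> RC Z. y \<in> Y closure_of (c ` {x \<in> topspace X. f x \<in> F})}"
    (is "RC_grill Z {F \<in> RC Z. y \<in> ?K F}")
proof -
  \<comment> \<open>Both upward closure and primeness of the grill are read off from this
    identity.\<close>
  have Un: "?K (F \<union> G) = ?K F \<union> ?K G" for F G
  proof -
    have "{x \<in> topspace X. f x \<in> F \<union> G} = {x \<in> topspace X. f x \<in> F} \<union> {x \<in> topspace X. f x \<in> G}"
      by blast
    then show ?thesis by (simp only: image_Un closure_of_Un)
  qed
  have "{x \<in> topspace X. f x \<in> topspace Z} = topspace X"
    using f by auto
  \<comment> \<open>Density makes the family non-empty: \<open>topspace Z\<close> belongs to it for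
    every \<open>y\<close>.\<close>
  then have "topspace Z \<in> {F \<in> RC Z. y \<in> ?K F}"
    using dense y topspace_in_RC[of Z] by simp
  moreover have "{} \<notin> {F \<in> RC Z. y \<in> ?K F}"
    by simp
  moreover have "b \<in> {F \<in> RC Z. y \<in> ?K F}"
    if "a \<in> {F \<in> RC Z. y \<in> ?K F}" "b \<in> RC Z" "a \<union> b = b" for a b
    using that Un[of a b] by auto
  moreover have "a \<in> {F \<in> RC Z. y \<in> ?K F} \<or> b \<in> {F \<in> RC Z. y \<in> ?K F}"
    if "a \<in> RC Z" "b \<in> RC Z" "a \<union> b \<in> {F \<in> RC Z. y \<in> ?K F}" for a b
    using that unfolding mem_Collect_eq Un by blast
  ultimately show ?thesis
    unfolding grill_def by blast
qed

lemma extremally_connected_extend: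
  assumes Z: "extremally_connected_space Z" and c: "embedding_map X Y c"
    and dense: "Y closure_of (c ` topspace X) = topspace Y" and f: "continuous_map X Z f"
  shows "\<exists>f'. continuous_map Y Z f' \<and> (\<forall>x\<in>topspace X. f x = (f' \<circ> c) x)"
proof -
  let ?K = "\<lambda>F. Y closure_of (c ` {x \<in> topspace X. f x \<in> F})"
  have base: "closed_base Z (RC Z)" and t0: "t0_space Z"
    using Z by (auto simp: extremally_connected_space_def semiregular_space_def)
  have fim: "f \<in> topspace X \<rightarrow> topspace Z"
    using f by (rule continuous_map_funspace)
  have "\<forall>y\<in>topspace Y. \<exists>t. t \<in> topspace Z \<and> {F \<in> RC Z. y \<in> ?K F} = point_grill Z t"
    using Z RC_grill_preimage_closures[OF fim dense]
    unfolding extremally_connected_space_def by blast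
  from bchoice[OF this]
  obtain f' where f'im: "\<And>y. y \<in> topspace Y \<Longrightarrow> f' y \<in> topspace Z"
    and f'_grill: "\<And>y. y \<in> topspace Y \<Longrightarrow> {F \<in> RC Z. y \<in> ?K F} = point_grill Z (f' y)"
    by blast
  \<comment> \<open>This describes \<open>f'\<close> completely in terms of regular closed sets;
    continuity and agreement with \<open>f\<close> are both derived from it.\<close>
  have f'_iff: "f' y \<in> F \<longleftrightarrow> y \<in> ?K F" if "y \<in> topspace Y" "F \<in> RC Z" for y F
    using f'_grill[OF that(1)] that(2) unfolding point_grill_def by blast
  have "continuous_map Y Z f'"
  proof (rule continuous_map_closed_base[OF base])
    show "f' \<in> topspace Y \<rightarrow> topspace Z"
      using f'im by blast
    fix F assume "F \<in> RC Z"
    then have "{y \<in> topspace Y. f' y \<in> F} = ?K F"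
      using f'_iff closure_of_subset_topspace[of Y] by blast
    then show "closedin Y {y \<in> topspace Y. f' y \<in> F}" by simp
  qed
  moreover have "f x = f' (c x)" if x: "x \<in> topspace X" for x
  proof (rule closed_base_separates[OF base t0])
    \<comment> \<open>The closure lemma is applied to the whole of \<open>X\<close>, where by
      density the closure of the image is \<open>topspace Y\<close>.\<close>
    have cx: "c x \<in> topspace Y"
      using embedding_map_in_closure_of_image_iff[OF c closedin_topspace x] x dense by simp
    show "f x \<in> topspace Z" "f' (c x) \<in> topspace Z"
      using fim x f'im[OF cx] by auto
    fix F assume F: "F \<in> RC Z"
    then have "closedin Z F"
      using base by (simp add: closed_base_def)
    with f have "closedin X {x \<in> topspace X. f x \<in> F}"
      by (rule closedin_continuous_map_preimage)
    \<comment> \<open>The preimage of \<open>F\<close> is closed in \<open>X\<close>, so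
      \<open>c x\<close> lies in the closure of its image exactly when \<open>f x\<close> lies in
      \<open>F\<close>.\<close>
    from embedding_map_in_closure_of_image_iff[OF c this x]
    show "f x \<in> F \<longleftrightarrow> f' (c x) \<in> F"
      using f'_iff[OF cx F] x by simp
  qed
  ultimately show ?thesis by auto
qed

theorem theorem9p7:
  fixes X :: "'a topology" and Z :: "'b topology" and cX :: "'c topology"
    and c :: "'a \<Rightarrow> 'c"
  assumes "extremally_disconnected_space X" and "compact_space X" and "Hausdorff_space X"
    and "extremally_connected_space Z"
    and "C_semiregular_extension X cX c"
  shows "(\<forall>f. continuous_map X Z f \<and> (\<forall>x\<in>topspace X. u_point Z (f x)) \<longrightarrow>
            (\<exists>f'. continuous_map cX Z f' \<and> (\<forall>x\<in>topspace X. f x = (f' \<circ> c) x)))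
       \<and> (\<forall>f. continuous_map X Z f \<and> open_map X Z f \<longrightarrow>
            (\<exists>f'. continuous_map cX Z f' \<and> (\<forall>x\<in>topspace X. f x = (f' \<circ> c) x)))"
proof -
  have "embedding_map X cX c" "cX closure_of (c ` topspace X) = topspace cX"
    using assms(5) by (auto simp: C_semiregular_extension_def)
  \<comment> \<open>Both conjuncts speak of continuous maps on \<open>X\<close>, and both extensions
    come from the dense embedding \<open>c\<close>.\<close>
  from extremally_connected_extend[OF assms(4) this] show ?thesis
    by blast
qed

end
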